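(* There is a constant $\tau > 0$ such that for every positive integer $N$ and every set of integers $\{a_1 < \cdots < a_n\} \subset \{1, \ldots, N\}$ with $n > (1-\tau) N$, one has $$M(a_1, \ldots, a_n) > \exp(\tau n).$$
   Context: For positive integers $a_1 < \cdots < a_n$ define $$M(a_1, \ldots, a_n) = \max_{|z|=1} \prod_{i=1}^n |1 - z^{a_i}|,$$ the maximum being over complex numbers $z$ of modulus 1. *)

theory Defs
  imports "HOL-Analysis.Analysis"
begin

text \<open>
  The increasing tuple of positive integers is given by the finite set of its entries.
  The maximum is over an infinite set, so it is written as a supremum;
  \<open>max_circle_prod_attained\<close> shows that it is attained.
\<close>

definition max_circle_prod :: "nat set \<Rightarrow> real" where
  "max_circle_prod A = (SUP z\<in>sphere (0::complex) 1. \<Prod>a\<in>A. cmod (1 - z ^ a))"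

lemma max_circle_prod_attained:
  "\<exists>z\<in>sphere 0 1. max_circle_prod A = (\<Prod>a\<in>A. cmod (1 - z ^ a)) \<and>
     (\<forall>w\<in>sphere 0 1. (\<Prod>a\<in>A. cmod (1 - w ^ a)) \<le> (\<Prod>a\<in>A. cmod (1 - z ^ a)))"
proof -
  let ?f = "\<lambda>z::complex. \<Prod>a\<in>A. cmod (1 - z ^ a)"
  have "compact (sphere (0::complex) 1)" "sphere (0::complex) 1 \<noteq> {}"
    by auto
  moreover have "continuous_on (sphere 0 1) ?f"
    by (intro continuous_intros)
  ultimately obtain z where z: "z \<in> sphere 0 1" "\<forall>w\<in>sphere 0 1. ?f w \<le> ?f z"
    using continuous_attains_sup by blast
  have "max_circle_prod A = ?f z"
    unfolding max_circle_prod_def using z by (intro cSup_eq_maximum) auto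
  with z show ?thesis by blast
qed

end

theory Submission
  imports Defs "HOL-Computational_Algebra.Polynomial"
begin

text \<open>
  Let \<open>m = N + 1 + N div 8\<close> and \<open>z = cis (2 * pi / m)\<close>. Then \<open>\<Prod>a = 1..<m. 1 - z ^ a\<close> equals \<open>m\<close>,
  and each factor with \<open>N < a < m\<close> has modulus at most \<open>2 * pi * (m - a) / m \<le> 2 * pi / 9 \<le> 8 / 9\<close>,
  so leaving these factors out makes the product exponentially large:
  the set \<open>{1..N}\<close> satisfies the bound with exponent \<open>N / 72\<close>.
  Deleting an element of \<open>{1..N}\<close> divides the product by at most \<open>2\<close>.
\<close>

text \<open>The powers \<open>z ^ k\<close> with \<open>1 \<le> k < m\<close> are the roots of
  \<open>q\<close>, the sum of \<open>X^i\<close> over \<open>i < m\<close>; hence \<open>q\<close>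
  equals the product \<open>p\<close> of linear factors, and evaluation at 1 gives the
  claim.\<close>

lemma prod_root_unity_factors:
  fixes z :: "'a::idom"
  assumes inj: "inj_on (\<lambda>k. z ^ k) {..<m}" and root: "z ^ m = 1" and m: "m > 0"
  shows "(\<Prod>a=1..<m. 1 - z ^ a) = of_nat m"
proof -
  define p where "p = (\<Prod>a=1..<m. [:- (z ^ a), 1:])"
  define q where "q = (\<Sum>i<m. monom (1::'a) i)"
  have deg_p: "degree p = m - 1"
    unfolding p_def by (subst degree_prod_sum_eq) auto
  have coeff_q: "coeff q i = (if i < m then 1 else 0)" for i
    by (simp add: q_def coeff_sum)
  have deg_q: "degree q \<le> m - 1"
    by (rule degree_le) (auto simp: coeff_q)
  have "p = q"
  \<comment> \<open>Only \<open>m - 1\<close> common values are available in degree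
    \<open>m - 1\<close>; the equal leading coefficients replace the missing one.\<close>
  proof (rule poly_eqI_degree_lead_coeff[where A = "(\<lambda>k. z ^ k) ` {1..<m}" and n = "m - 1"])
    have "lead_coeff p = 1"
      unfolding p_def by (simp add: lead_coeff_prod)
    then show "coeff p (m - 1) = coeff q (m - 1)"
      using m by (simp add: deg_p coeff_q)
    have "inj_on (\<lambda>k. z ^ k) {1..<m}"
      by (rule inj_on_subset[OF inj]) auto
    then show "m - 1 \<le> card ((\<lambda>k. z ^ k) ` {1..<m})"
      by (simp add: card_image)
    fix x assume "x \<in> (\<lambda>k. z ^ k) ` {1..<m}"
    then obtain k where k: "1 \<le> k" "k < m" and x: "x = z ^ k"
      by auto
    \<comment> \<open>Here 1 is \<open>z ^ 0\<close>, so injectivity is needed at exponent 0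
      too.\<close>
    have "x \<noteq> 1"
      using inj_onD[OF inj, of k 0] k x by auto
    moreover have "x ^ m = 1"
      by (metis x root power_mult mult.commute power_one)
    then have "(x - 1) * (\<Sum>i<m. x ^ i) = 0"
      by (metis power_diff_1_eq eq_iff_diff_eq_0)
    ultimately have "poly q x = 0"
      by (simp add: q_def poly_sum poly_monom)
    moreover have "poly p x = 0"
      using k by (auto simp: p_def poly_prod x)
    ultimately show "poly p x = poly q x"
      by simp
  qed (use deg_p deg_q in auto)
  then have "poly p 1 = poly q 1"
    by simp
  then show ?thesis
    by (simp add: p_def q_def poly_prod poly_sum poly_monom)
qed

text \<open>A chord is no longer than its arc.\<close>

lemma norm_one_minus_cis_le: "cmod (1 - cis t) \<le> \<bar>t\<bar>"
  using dist_exp_i_1[of t] abs_sin_x_le_abs_x[of "t / 2"]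
  by (simp add: cis_conv_exp norm_minus_commute)

lemma max_circle_prod_ge:
  assumes "cmod z = 1"
  shows "(\<Prod>a\<in>A. cmod (1 - z ^ a)) \<le> max_circle_prod A"
  using max_circle_prod_attained[of A] assms by auto

text \<open>At a point where the product over \<open>B\<close> is maximal, each removed factor is at
  most 2.\<close>

lemma max_circle_prod_mono_diff:
  assumes "finite B" "A \<subseteq> B"
  shows "max_circle_prod B \<le> 2 ^ card (B - A) * max_circle_prod A"
proof -
  obtain z where z: "cmod z = 1" and max: "max_circle_prod B = (\<Prod>a\<in>B. cmod (1 - z ^ a))"
    using max_circle_prod_attained[of B] by auto
  have "cmod (1 - z ^ a) \<le> 2" for a
    using norm_triangle_ineq4[of 1 "z ^ a"] by (simp add: z norm_power)
  then have "(\<Prod>a\<in>B - A. cmod (1 - z ^ a)) \<le> (\<Prod>a\<in>B - A. 2)"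
    by (intro prod_mono) auto
  then have removed: "(\<Prod>a\<in>B - A. cmod (1 - z ^ a)) \<le> 2 ^ card (B - A)"
    by simp
  have "max_circle_prod B = (\<Prod>a\<in>B - A. cmod (1 - z ^ a)) * (\<Prod>a\<in>A. cmod (1 - z ^ a))"
    unfolding max using assms by (rule prod.subset_diff[rotated])
  also have "\<dots> \<le> 2 ^ card (B - A) * max_circle_prod A"
    by (intro mult_mono removed max_circle_prod_ge z prod_nonneg) auto
  finally show ?thesis .
qed

lemma max_circle_prod_atLeastAtMost_ge:
  "exp (real N / 72) \<le> max_circle_prod {1..N}"
proof -
  define k where "k = N div 8"
  define m where "m = N + 1 + k"
  define z where "z = cis (2 * pi / real m)"
  have m: "m > 0"
    by (simp add: m_def)
  have z_pow: "z ^ a = cis (2 * pi * real a / real m)" for a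
    by (simp add: z_def Complex.DeMoivre mult_ac)
  have root: "z ^ m = 1"
    using m by (simp add: z_pow)
  have "inj_on (\<lambda>a. z ^ a) {..<m}"
    using Complex.bij_betw_roots_unity[OF m] by (simp add: z_pow bij_betw_def)
  from prod_root_unity_factors[OF this root m]
  have "(\<Prod>a=1..<m. cmod (1 - z ^ a)) = real m"
    by (metis prod_norm norm_of_nat)
  moreover have "{1..<m} = {1..N} \<union> {N+1..<m}"
    by (auto simp: m_def)
  moreover have "{1..N} \<inter> {N+1..<m} = {}"
    by auto
  ultimately have split:
    "(\<Prod>a=1..N. cmod (1 - z ^ a)) * (\<Prod>a=N+1..<m. cmod (1 - z ^ a)) = real m"
    by (metis prod.union_disjoint finite_atLeastAtMost finite_atLeastLessThan)
  have k8: "8 * k \<le> N" "N \<le> 8 * k + 7"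
    unfolding k_def by linarith+
  have small: "cmod (1 - z ^ a) \<le> exp (- (1 / 9))" if a: "a \<in> {N+1..<m}" for a
  proof -
    \<comment> \<open>Subtracting a full turn makes the angle small, since \<open>a\<close> is close
      to \<open>m\<close>.\<close>
    have "z ^ a = cis (2 * pi * real a / real m - 2 * pi)"
      by (simp add: z_pow cis_divide[symmetric])
    then have "cmod (1 - z ^ a) \<le> \<bar>2 * pi * real a / real m - 2 * pi\<bar>"
      by (metis norm_one_minus_cis_le)
    also have "2 * pi * real a / real m - 2 * pi = - (2 * pi * (real (m - a) / real m))"
      using a m by (simp add: field_simps of_nat_diff)
    also have "\<bar>\<dots>\<bar> = 2 * pi * (real (m - a) / real m)"
      by (simp add: abs_mult)
    also have "m - a \<le> k"
      using a by (auto simp: m_def)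
    \<comment> \<open>Indeed \<open>m \<ge> 8 * k + 1 + k\<close>, so
      \<open>9 * k \<le> m\<close>.\<close>
    then have "9 * (m - a) \<le> m"
      using k8 by (simp add: m_def)
    then have "2 * pi * (real (m - a) / real m) \<le> 2 * 4 * (1 / 9)"
      using m pi_less_4 by (intro mult_mono) (auto simp: field_simps)
    \<comment> \<open>This is \<open>8 / 9 = 1 + (- 1 / 9)\<close>, bounded by
      \<open>1 + x \<le> exp x\<close>.\<close>
    also have "\<dots> \<le> exp (- (1 / 9 :: real))"
      using exp_ge_add_one_self[of "- (1 / 9 :: real)"] by simp
    finally show ?thesis .
  qed
  have "(\<Prod>a=N+1..<m. cmod (1 - z ^ a)) \<le> (\<Prod>a=N+1..<m. exp (- (1 / 9)))"
    using small by (intro prod_mono) auto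
  also have "\<dots> = exp (- (real k / 9))"
    by (simp add: m_def exp_of_nat_mult[symmetric])
  finally have "real m \<le> (\<Prod>a=1..N. cmod (1 - z ^ a)) * exp (- (real k / 9))"
    unfolding split[symmetric] by (intro mult_left_mono prod_nonneg) auto
  then have big: "real m * exp (real k / 9) \<le> (\<Prod>a=1..N. cmod (1 - z ^ a))"
    by (simp add: exp_minus field_simps)
  \<comment> \<open>Rounding in \<open>k\<close> costs at most a factor \<open>exp (7 / 72)\<close>,
    which \<open>m \<ge> 2\<close> absorbs when \<open>N > 0\<close>; for \<open>N = 0\<close> both
    sides are 1.\<close>
  have "exp (real N / 72) \<le> real m * exp (real k / 9)"
  proof (cases "N = 0")
    case True
    then show ?thesis
      by (simp add: m_def k_def)
  next
    case False
    have "exp (real N / 72) \<le> exp (7 / 72) * exp (real k / 9)"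
      using k8 by (simp add: exp_add[symmetric])
    also have "exp (7 / 72 :: real) \<le> 1 + 7 / 72 + (7 / 72)\<^sup>2"
      by (rule exp_bound) auto
    also have "\<dots> \<le> real m"
      using False by (simp add: m_def power2_eq_square)
    finally show ?thesis
      by simp
  qed
  also note big
  also have "(\<Prod>a=1..N. cmod (1 - z ^ a)) \<le> max_circle_prod {1..N}"
    by (rule max_circle_prod_ge) (simp add: z_def)
  finally show ?thesis .
qed

theorem proposition1p2:
  shows "\<exists>\<tau>::real. \<tau> > 0 \<and>
    (\<forall>(N::nat) (A::nat set). N > 0 \<and> A \<subseteq> {1..N} \<and> real (card A) > (1 - \<tau>) * real N \<longrightarrow>
      max_circle_prod A > exp (\<tau> * real (card A)))"
proof (intro exI[of _ "1 / 144"] conjI allI impI)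
  fix N :: nat and A :: "nat set"
  assume "N > 0 \<and> A \<subseteq> {1..N} \<and> real (card A) > (1 - 1 / 144) * real N"
  then have A: "A \<subseteq> {1..N}" and card_A: "real (card A) > (1 - 1 / 144) * real N"
    by auto
  define d where "d = card ({1..N} - A)"
  have card_le: "card A \<le> N"
    using card_mono[OF _ A] by simp
  have d: "d = N - card A"
    unfolding d_def using A by (subst card_Diff_subset) (auto intro: finite_subset)
  have two_le: "(2::real) ^ d \<le> exp (real d)"
    using power_mono[OF exp_ge_add_one_self[of 1], of d] by (simp add: exp_of_nat_mult[symmetric])
  \<comment> \<open>Both \<open>card A / 144 \<le> N / 144\<close> and \<open>d < N / 144\<close>
    hold, and the two bounds add up to \<open>N / 72\<close>.\<close>
  have "exp (1 / 144 * real (card A)) * exp (real d) < exp (real N / 72)"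
    using card_A card_le by (simp add: exp_add[symmetric] d of_nat_diff)
  also have "\<dots> \<le> max_circle_prod {1..N}"
    by (rule max_circle_prod_atLeastAtMost_ge)
  also have "\<dots> \<le> 2 ^ d * max_circle_prod A"
    unfolding d_def using A by (intro max_circle_prod_mono_diff) auto
  also have "\<dots> \<le> exp (real d) * max_circle_prod A"
    \<comment> \<open>The nonnegative product at \<open>z = 1\<close> shows that
      \<open>max_circle_prod A\<close> is nonnegative.\<close>
    using order_trans[OF prod_nonneg max_circle_prod_ge[of 1 A]]
    by (intro mult_right_mono two_le) auto
  finally show "max_circle_prod A > exp (1 / 144 * real (card A))"
    by (simp add: mult.commute)
qed simp

end
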